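(* Let $((A_h\oplus A_h^\star,\odot_h),A_h,A_h^\star)$ be an associative Manin triple deformation of a standard Manin triple of commutative associative algebras $((A\oplus A^*,\odot),A,A^* )$ and let $((A\oplus A^*,\llbracket,\rrbracket,\odot),A,A^* )$ be the QCL. Then $((A\oplus A^*,\llbracket,\rrbracket,\odot),A,A^* )$ is a standard Manin triple of Poisson algebras.
   Context: Conventions. $\mathbf{k}$ is a field of characteristic $0$, $\mathbf{K}=\mathbf{k}[[h]]$; vector spaces and algebras are over $\mathbf{k}$, not necessarily unital. For a vector space $V$, $V_h:=V[[h]]\supset V$; $\equiv\pmod h$ means equality modulo $hV_h$. $V^*=\mathrm{Hom}_{\mathbf{k}}(V,\mathbf{k})$ with natural pairing $\langle,\rangle$; $V_h^\star:=(V^* )_h\cong\mathrm{Hom}_{\mathbf{K}}(V_h,\mathbf{K})$ with pairing $\langle\sum_s u_s^*h^s,\sum_l v_lh^l\rangle_{\mathbf{K}}=\sum_{s,l}\langle u_s^*,v_l\rangle h^{s+l}$. $A_h\oplus A_h^\star$ is identified with $(A\oplus A^* )_h$. Topologically free associative algebra: a $\mathbf{K}$-module isomorphic to some $V[[h]]$ with an associative $\mathbf{K}$-bilinear operation. Associative deformation of an associative algebra $(C,\odot)$: a topologically free associative algebra $(C_h,\odot_h)$, $C_h=C[[h]]$, with $x\odot_h y\equiv x\odot y\pmod h$ for $x,y\in C$. If $\odot$ is commutative, its quasiclassical limit (QCL) is $(C,\llbracket,\rrbracket,\odot)$ with $\llbracket x,y\rrbracket\in C$ determined by $\llbracket x,y\rrbracket\equiv\frac{x\odot_h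 y-y\odot_h x}{h}\pmod h$. Poisson algebra $(P,\{,\},\circ)$: a Lie algebra $(P,\{,\})$ and a commutative associative algebra $(P,\circ)$ with $\{x,y\circ z\}=\{x,y\}\circ z+y\circ\{x,z\}$. Invariance: a bilinear form $\mathfrak{B}$ on an associative algebra $(C,\odot)$ is invariant if $\mathfrak{B}(x\odot y,z)=\mathfrak{B}(x,y\odot z)$ (similarly for $\mathbf{K}$-bilinear forms on topologically free associative algebras); on a Poisson algebra $(P,\{,\},\circ)$ it is invariant if $\mathfrak{B}(x\circ y,z)=\mathfrak{B}(x,y\circ z)$ and $\mathfrak{B}(\{x,y\},z)=\mathfrak{B}(x,\{y,z\})$. On $A\oplus A^*$ let $\mathfrak{B}(x+a^*,y+b^* )=\langle a^*,y\rangle+\langle b^*,x\rangle$; on $A_h\oplus A_h^\star$ let $\mathfrak{B}_h(x_h+a^\star,y_h+b^\star)=\langle a^\star,y_h\rangle_{\mathbf{K}}+\langle b^\star,x_h\rangle_{\mathbf{K}}$. Standard Manin triple of associative algebras $((A\oplus A^*,\odot),A,A^* )$: $(A\oplus A^*,\odot)$ is an associative algebra with $A$ and $A^*$ subalgebras and $\mathfrak{B}$ invariant; it is a standard Manin triple of commutative associative algebras if $\odot$ is commutative. Standard Manin triple of topologically free associative algebras $((A_h\oplus A_h^\star,\odot_h),A_h,A_h^\star)$: $(A_h\oplus A_h^\star,\odot_h)$ is a topologically free associative algebra with $A_h$, $A_h^\star$ subalgebras and $\mathfrak{B}_h$ invariant. Standard Manin triple of Poisson algebras $((A\oplus A^*,\llbracket,\rrbracket,\odot),A,A^*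 )$: a Poisson algebra $(A\oplus A^*,\llbracket,\rrbracket,\odot)$ with $A$ and $A^*$ Poisson subalgebras and $\mathfrak{B}$ invariant. Associative Manin triple deformation of $((A\oplus A^*,\odot),A,A^* )$: a standard Manin triple of topologically free associative algebras $((A_h\oplus A_h^\star,\odot_h),A_h,A_h^\star)$, $A_h=A[[h]]$, such that $(A_h\oplus A_h^\star,\odot_h)$ is an associative deformation of $(A\oplus A^*,\odot)$. If $\odot$ is commutative and $(A\oplus A^*,\llbracket,\rrbracket,\odot)$ is the QCL of $(A_h\oplus A_h^\star,\odot_h)$, then the QCL of the associative Manin triple deformation is $((A\oplus A^*,\llbracket,\rrbracket,\odot),A,A^* )$. *)

theory Defs
  imports
    "HOL-Computational_Algebra.Formal_Power_Series"
    "HOL-Library.Function_Algebras"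
    "HOL-Library.Product_Plus"
begin

unbundle fps_syntax

text \<open>
  Vector spaces and modules are given by a scalar multiplication \<open>s\<close> on an ambient type (locale
  \<^locale>\<open>module\<close>, which for a field of scalars is \<^locale>\<open>vector_space\<close>) together with a
  carrier \<open>V\<close>, a submodule of that type. Operations are functions on the ambient type of which
  only the values on the carrier matter.

  \<open>\<K> = \<k>[[h]]\<close> is the type \<open>'k fps\<close>, and \<open>h\<close> is \<^term>\<open>fps_X\<close>. The space \<open>V[[h]]\<close> consists of
  the series of type \<open>'v fps\<close> with all coefficients in \<open>V\<close>; the inclusion of \<open>V\<close> into
  \<open>V[[h]]\<close> is \<^term>\<open>fps_const\<close>.
\<close>

section \<open>Formal power series with coefficients in a vector space\<close>

definition series :: "'v set \<Rightarrow> 'v fps set" where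
  "series V = {x. \<forall>n. x $ n \<in> V}"

definition series_scale ::
  "('k \<Rightarrow> 'v \<Rightarrow> 'v) \<Rightarrow> 'k fps \<Rightarrow> 'v fps \<Rightarrow> ('v::ab_group_add) fps" where
  "series_scale s c x = Abs_fps (\<lambda>n. \<Sum>i=0..n. s (c $ i) (x $ (n - i)))"

definition cong_mod_h ::
  "('k::field_char_0 \<Rightarrow> 'v \<Rightarrow> 'v) \<Rightarrow> 'v set \<Rightarrow> ('v::ab_group_add) fps \<Rightarrow> 'v fps \<Rightarrow> bool" where
  "cong_mod_h s V u v \<longleftrightarrow> (\<exists>w\<in>series V. u - v = series_scale s fps_X w)"

definition linear_iso_on ::
  "('r \<Rightarrow> 'v \<Rightarrow> 'v) \<Rightarrow> 'v set \<Rightarrow> ('r \<Rightarrow> 'w \<Rightarrow> 'w) \<Rightarrow> 'w set \<Rightarrow>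
    ('v::ab_group_add \<Rightarrow> 'w::ab_group_add) \<Rightarrow> bool" where
  "linear_iso_on s V t W f \<longleftrightarrow> bij_betw f V W \<and>
     (\<forall>x\<in>V. \<forall>y\<in>V. f (x + y) = f x + f y) \<and> (\<forall>c. \<forall>x\<in>V. f (s c x) = t c (f x))"

text \<open>
  The space \<open>V\<close> with \<open>M \<cong> V[[h]]\<close> may be taken inside \<open>M\<close>, namely as the image of the constant
  series; this avoids quantifying over types.
\<close>

definition topologically_free ::
  "('k::field_char_0 fps \<Rightarrow> 'm \<Rightarrow> 'm) \<Rightarrow> ('m::ab_group_add) set \<Rightarrow> bool" where
  "topologically_free S M \<longleftrightarrow> module S \<and> module.subspace S M \<and>
     (let s = (\<lambda>c. S (fps_const c)) in
       \<exists>V \<phi>. module.subspace s V \<and> linear_iso_on (series_scale s) (series V) S M \<phi>)"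

section \<open>Algebras and invariant forms\<close>

definition bilinear_op_on ::
  "('r \<Rightarrow> 'v \<Rightarrow> 'v) \<Rightarrow> 'v set \<Rightarrow> ('v \<Rightarrow> 'v \<Rightarrow> 'v::ab_group_add) \<Rightarrow> bool" where
  "bilinear_op_on s V m \<longleftrightarrow>
     (\<forall>x\<in>V. \<forall>y\<in>V. m x y \<in> V) \<and>
     (\<forall>x\<in>V. \<forall>y\<in>V. \<forall>z\<in>V. m (x + y) z = m x z + m y z \<and> m x (y + z) = m x y + m x z) \<and>
     (\<forall>c. \<forall>x\<in>V. \<forall>y\<in>V. m (s c x) y = s c (m x y) \<and> m x (s c y) = s c (m x y))"

definition associative_algebra ::
  "('r::comm_ring_1 \<Rightarrow> 'v \<Rightarrow> 'v) \<Rightarrow> 'v set \<Rightarrow> ('v \<Rightarrow> 'v \<Rightarrow> 'v::ab_group_add) \<Rightarrow> bool" where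
  "associative_algebra s V m \<longleftrightarrow> module s \<and> module.subspace s V \<and> bilinear_op_on s V m \<and>
     (\<forall>x\<in>V. \<forall>y\<in>V. \<forall>z\<in>V. m (m x y) z = m x (m y z))"

definition commutative_on :: "'v set \<Rightarrow> ('v \<Rightarrow> 'v \<Rightarrow> 'v) \<Rightarrow> bool" where
  "commutative_on V m \<longleftrightarrow> (\<forall>x\<in>V. \<forall>y\<in>V. m x y = m y x)"

definition lie_algebra ::
  "('r::comm_ring_1 \<Rightarrow> 'v \<Rightarrow> 'v) \<Rightarrow> 'v set \<Rightarrow> ('v \<Rightarrow> 'v \<Rightarrow> 'v::ab_group_add) \<Rightarrow> bool" where
  "lie_algebra s V br \<longleftrightarrow> module s \<and> module.subspace s V \<and> bilinear_op_on s V br \<and>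
     (\<forall>x\<in>V. br x x = 0) \<and>
     (\<forall>x\<in>V. \<forall>y\<in>V. \<forall>z\<in>V. br x (br y z) + br y (br z x) + br z (br x y) = 0)"

definition poisson_algebra ::
  "('r::comm_ring_1 \<Rightarrow> 'v \<Rightarrow> 'v) \<Rightarrow> 'v set \<Rightarrow> ('v \<Rightarrow> 'v \<Rightarrow> 'v) \<Rightarrow>
    ('v \<Rightarrow> 'v \<Rightarrow> 'v::ab_group_add) \<Rightarrow> bool" where
  "poisson_algebra s V br m \<longleftrightarrow>
     lie_algebra s V br \<and> associative_algebra s V m \<and> commutative_on V m \<and>
     (\<forall>x\<in>V. \<forall>y\<in>V. \<forall>z\<in>V. br x (m y z) = m (br x y) z + m y (br x z))"

definition subalgebra ::
  "('r::comm_ring_1 \<Rightarrow> 'v \<Rightarrow> 'v) \<Rightarrow> 'v set \<Rightarrow> ('v \<Rightarrow> 'v \<Rightarrow> 'v::ab_group_add) \<Rightarrow> 'v set \<Rightarrow> bool"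
  where
  "subalgebra s V m U \<longleftrightarrow> U \<subseteq> V \<and> module.subspace s U \<and> (\<forall>x\<in>U. \<forall>y\<in>U. m x y \<in> U)"

definition invariant_form ::
  "'v set \<Rightarrow> ('v \<Rightarrow> 'v \<Rightarrow> 'v) \<Rightarrow> ('v \<Rightarrow> 'v \<Rightarrow> 'r) \<Rightarrow> bool" where
  "invariant_form V m B \<longleftrightarrow> (\<forall>x\<in>V. \<forall>y\<in>V. \<forall>z\<in>V. B (m x y) z = B x (m y z))"

definition topologically_free_associative_algebra ::
  "('k::field_char_0 fps \<Rightarrow> 'm \<Rightarrow> 'm) \<Rightarrow> 'm set \<Rightarrow> ('m \<Rightarrow> 'm \<Rightarrow> 'm::ab_group_add) \<Rightarrow> bool" where
  "topologically_free_associative_algebra S M m \<longleftrightarrow>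
     topologically_free S M \<and> associative_algebra S M m"

section \<open>Deformations and the quasiclassical limit\<close>

definition associative_deformation ::
  "('k::field_char_0 \<Rightarrow> 'v \<Rightarrow> 'v) \<Rightarrow> 'v set \<Rightarrow> ('v \<Rightarrow> 'v \<Rightarrow> 'v::ab_group_add) \<Rightarrow>
    ('v fps \<Rightarrow> 'v fps \<Rightarrow> 'v fps) \<Rightarrow> bool" where
  "associative_deformation s C m mh \<longleftrightarrow>
     associative_algebra s C m \<and>
     topologically_free_associative_algebra (series_scale s) (series C) mh \<and>
     (\<forall>x\<in>C. \<forall>y\<in>C. cong_mod_h s C (mh (fps_const x) (fps_const y)) (fps_const (m x y)))"

text \<open>The series \<open>z\<close> below is the commutator divided by \<open>h\<close>.\<close>

definition qcl_bracket ::
  "('k::field_char_0 \<Rightarrow> 'v \<Rightarrow> 'v) \<Rightarrow> 'v set \<Rightarrow> ('v fps \<Rightarrow> 'v fps \<Rightarrow> 'v fps) \<Rightarrow>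
    'v \<Rightarrow> 'v \<Rightarrow> 'v::ab_group_add" where
  "qcl_bracket s C mh x y = (THE c. c \<in> C \<and>
     (\<exists>z\<in>series C.
        series_scale s fps_X z
          = mh (fps_const x) (fps_const y) - mh (fps_const y) (fps_const x) \<and>
        cong_mod_h s C (fps_const c) z))"

section \<open>The space $A \oplus A^*$ and standard Manin triples\<close>

text \<open>
  \<open>A\<close> is a whole type \<open>'a\<close> with scalar multiplication \<open>s\<close>, and \<open>A \<oplus> A\<^sup>*\<close> is a subspace of the type
  \<open>'a \<times> ('a \<Rightarrow> 'k)\<close>. Both \<open>A\<^sub>h\<close> and \<open>A\<^sub>h\<^sup>\<star> = (A\<^sup>*)\<^sub>h\<close> are regarded as subsets of
  \<open>(A \<oplus> A\<^sup>*)\<^sub>h\<close>.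
\<close>

definition dual :: "('k::field_char_0 \<Rightarrow> 'a::ab_group_add \<Rightarrow> 'a) \<Rightarrow> ('a \<Rightarrow> 'k) set" where
  "dual s = {f. Vector_Spaces.linear s (*) f}"

definition double :: "('k::field_char_0 \<Rightarrow> 'a::ab_group_add \<Rightarrow> 'a) \<Rightarrow> ('a \<times> ('a \<Rightarrow> 'k)) set" where
  "double s = UNIV \<times> dual s"

definition double_scale ::
  "('k::field_char_0 \<Rightarrow> 'a::ab_group_add \<Rightarrow> 'a) \<Rightarrow> 'k \<Rightarrow> 'a \<times> ('a \<Rightarrow> 'k) \<Rightarrow> 'a \<times> ('a \<Rightarrow> 'k)" where
  "double_scale s c u = (s c (fst u), (\<lambda>y. c * snd u y))"

definition double_A :: "('a::ab_group_add \<times> ('a \<Rightarrow> 'k::field_char_0)) set" where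
  "double_A = UNIV \<times> {0}"

definition double_A_dual ::
  "('k::field_char_0 \<Rightarrow> 'a::ab_group_add \<Rightarrow> 'a) \<Rightarrow> ('a \<times> ('a \<Rightarrow> 'k)) set" where
  "double_A_dual s = {0} \<times> dual s"

definition form :: "'a \<times> ('a \<Rightarrow> 'k) \<Rightarrow> 'a \<times> ('a \<Rightarrow> 'k) \<Rightarrow> 'k::field_char_0" where
  "form u v = snd u (fst v) + snd v (fst u)"

definition pairing_h :: "('a \<Rightarrow> 'k) fps \<Rightarrow> 'a fps \<Rightarrow> ('k::field_char_0) fps" where
  "pairing_h a x = Abs_fps (\<lambda>n. \<Sum>i=0..n. (a $ i) (x $ (n - i)))"

definition form_h ::
  "('a \<times> ('a \<Rightarrow> 'k)) fps \<Rightarrow> ('a \<times> ('a \<Rightarrow> 'k)) fps \<Rightarrow> ('k::field_char_0) fps" where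
  "form_h u v =
     (let A_part = (\<lambda>w. Abs_fps (\<lambda>n. fst (w $ n)));
          dual_part = (\<lambda>w. Abs_fps (\<lambda>n. snd (w $ n)))
      in pairing_h (dual_part u) (A_part v) + pairing_h (dual_part v) (A_part u))"

definition manin_triple_assoc ::
  "('k::field_char_0 \<Rightarrow> 'a \<Rightarrow> 'a) \<Rightarrow>
    ('a \<times> ('a \<Rightarrow> 'k) \<Rightarrow> 'a \<times> ('a \<Rightarrow> 'k) \<Rightarrow> 'a::ab_group_add \<times> ('a \<Rightarrow> 'k)) \<Rightarrow> bool" where
  "manin_triple_assoc s m \<longleftrightarrow>
     associative_algebra (double_scale s) (double s) m \<and>
     subalgebra (double_scale s) (double s) m double_A \<and>
     subalgebra (double_scale s) (double s) m (double_A_dual s) \<and>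
     invariant_form (double s) m form"

definition manin_triple_comm_assoc ::
  "('k::field_char_0 \<Rightarrow> 'a \<Rightarrow> 'a) \<Rightarrow>
    ('a \<times> ('a \<Rightarrow> 'k) \<Rightarrow> 'a \<times> ('a \<Rightarrow> 'k) \<Rightarrow> 'a::ab_group_add \<times> ('a \<Rightarrow> 'k)) \<Rightarrow> bool" where
  "manin_triple_comm_assoc s m \<longleftrightarrow> manin_triple_assoc s m \<and> commutative_on (double s) m"

definition manin_triple_assoc_h ::
  "('k::field_char_0 \<Rightarrow> 'a \<Rightarrow> 'a) \<Rightarrow>
    (('a \<times> ('a \<Rightarrow> 'k)) fps \<Rightarrow> ('a \<times> ('a \<Rightarrow> 'k)) fps \<Rightarrow> ('a::ab_group_add \<times> ('a \<Rightarrow> 'k)) fps) \<Rightarrow> bool"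
  where
  "manin_triple_assoc_h s mh \<longleftrightarrow>
     (let S = series_scale (double_scale s); D = series (double s) in
       topologically_free_associative_algebra S D mh \<and>
       subalgebra S D mh (series double_A) \<and>
       subalgebra S D mh (series (double_A_dual s)) \<and>
       invariant_form D mh form_h)"

definition manin_triple_poisson ::
  "('k::field_char_0 \<Rightarrow> 'a \<Rightarrow> 'a) \<Rightarrow>
    ('a \<times> ('a \<Rightarrow> 'k) \<Rightarrow> 'a \<times> ('a \<Rightarrow> 'k) \<Rightarrow> 'a \<times> ('a \<Rightarrow> 'k)) \<Rightarrow>
    ('a \<times> ('a \<Rightarrow> 'k) \<Rightarrow> 'a \<times> ('a \<Rightarrow> 'k) \<Rightarrow> 'a::ab_group_add \<times> ('a \<Rightarrow> 'k)) \<Rightarrow> bool" where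
  "manin_triple_poisson s br m \<longleftrightarrow>
     poisson_algebra (double_scale s) (double s) br m \<and>
     (\<forall>U\<in>{double_A, double_A_dual s}.
        subalgebra (double_scale s) (double s) br U \<and>
        subalgebra (double_scale s) (double s) m U) \<and>
     invariant_form (double s) br form \<and>
     invariant_form (double s) m form"

definition manin_triple_deformation ::
  "('k::field_char_0 \<Rightarrow> 'a \<Rightarrow> 'a) \<Rightarrow>
    ('a \<times> ('a \<Rightarrow> 'k) \<Rightarrow> 'a \<times> ('a \<Rightarrow> 'k) \<Rightarrow> 'a \<times> ('a \<Rightarrow> 'k)) \<Rightarrow>
    (('a \<times> ('a \<Rightarrow> 'k)) fps \<Rightarrow> ('a \<times> ('a \<Rightarrow> 'k)) fps \<Rightarrow> ('a::ab_group_add \<times> ('a \<Rightarrow> 'k)) fps) \<Rightarrow> bool"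
  where
  "manin_triple_deformation s m mh \<longleftrightarrow>
     manin_triple_assoc_h s mh \<and>
     associative_deformation (double_scale s) (double s) m mh"

section \<open>Adequacy of the encoding\<close>

lemma module_series_scale:
  fixes s :: "'k::field_char_0 \<Rightarrow> 'v::ab_group_add \<Rightarrow> 'v"
  assumes "module s"
  shows "module (series_scale s)"
proof -
  interpret module s by fact
  show ?thesis
  proof
    fix a b :: "'k fps" and x y :: "'v fps"
    show "series_scale s a (x + y) = series_scale s a x + series_scale s a y"
      by (simp add: series_scale_def fps_eq_iff scale_right_distrib sum.distrib)
    show "series_scale s (a + b) x = series_scale s a x + series_scale s b x"
      by (simp add: series_scale_def fps_eq_iff scale_left_distrib sum.distrib)
    show "series_scale s 1 x = x"
    proof (rule fps_ext)
      fix n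
      have "series_scale s 1 x $ n = (\<Sum>i=0..n. if i = 0 then x $ n else 0)"
        unfolding series_scale_def fps_nth_Abs_fps by (rule sum.cong) auto
      then show "series_scale s 1 x $ n = x $ n" by simp
    qed
    show "series_scale s a (series_scale s b x) = series_scale s (a * b) x"
    proof (rule fps_ext)
      fix n
      have "(\<Sum>j=0..n. \<Sum>i=0..j. s (a$i * b$(j - i)) (x$(n - j))) =
          (\<Sum>j=0..n. \<Sum>i=0..n - j. s (a$j * b$i) (x$(n - j - i)))"
        by (rule fps_mult_assoc_lemma)
      then show "series_scale s a (series_scale s b x) $ n = series_scale s (a * b) x $ n"
        by (simp add: series_scale_def fps_mult_nth scale_sum_right scale_sum_left)
    qed
  qed
qed

lemma subspace_series:
  fixes s :: "'k::field_char_0 \<Rightarrow> 'v::ab_group_add \<Rightarrow> 'v"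
  assumes "module s" "module.subspace s V"
  shows "module.subspace (series_scale s) (series V)"
proof -
  interpret module s by fact
  interpret h: module "series_scale s" by (rule module_series_scale) fact
  show ?thesis
    using assms(2)
    by (auto simp: h.subspace_def series_def series_scale_def
        intro!: subspace_sum subspace_scale intro: subspace_0 subspace_add)
qed

lemma series_scale_const:
  fixes s :: "'k::field_char_0 \<Rightarrow> 'v::ab_group_add \<Rightarrow> 'v"
  assumes "module s"
  shows "series_scale s (fps_const c) x $ n = s c (x $ n)"
proof -
  interpret module s by fact
  have "series_scale s (fps_const c) x $ n = (\<Sum>i=0..n. if i = 0 then s c (x $ n) else 0)"
    unfolding series_scale_def fps_nth_Abs_fps by (rule sum.cong) auto
  then show ?thesis by simp
qed

lemma topologically_free_series:
  fixes s :: "'k::field_char_0 \<Rightarrow> 'v::ab_group_add \<Rightarrow> 'v"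
  assumes "module s" "module.subspace s V"
  shows "topologically_free (series_scale s) (series V)"
proof -
  interpret module s by fact
  interpret h: module "series_scale s" by (rule module_series_scale) fact
  define t where "t = (\<lambda>c. series_scale s (fps_const c))"
  define \<phi> where "\<phi> = (\<lambda>F :: 'v fps fps. Abs_fps (\<lambda>n. F $ n $ 0))"
  have t: "t c (fps_const x) = fps_const (s c x)" for c x
    by (rule fps_ext) (simp add: t_def series_scale_const[OF assms(1)])
  have tm: "module t"
  proof
    show "t (a + b) x = t a x + t b x" for a b x
      unfolding t_def h.scale_left_distrib[symmetric] by simp
  qed (simp_all add: t_def h.scale_right_distrib)
  interpret t: module t by (rule tm)
  have sub: "t.subspace (fps_const ` V)"
  proof (rule t.subspaceI)
    show "0 \<in> fps_const ` V"
      using subspace_0[OF assms(2)] by (intro image_eqI[of _ _ 0]) auto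
    fix c x assume "x \<in> fps_const ` V"
    then show "t c x \<in> fps_const ` V"
      using subspace_scale[OF assms(2)] by (auto simp: t)
  next
    fix x y assume "x \<in> fps_const ` V" "y \<in> fps_const ` V"
    then show "x + y \<in> fps_const ` V"
      using subspace_add[OF assms(2)] by auto
  qed
  have const: "F $ n = fps_const (F $ n $ 0)" if "F \<in> series (fps_const ` V)"
    for F :: "'v fps fps" and n
  proof -
    have "F $ n \<in> fps_const ` V" using that by (simp add: series_def)
    then show ?thesis by auto
  qed
  have "bij_betw \<phi> (series (fps_const ` V)) (series V)"
  proof (rule bij_betwI[where g = "\<lambda>x. Abs_fps (\<lambda>n. fps_const (x $ n))"])
    show "\<phi> \<in> series (fps_const ` V) \<rightarrow> series V"
    proof
      fix F :: "'v fps fps" assume "F \<in> series (fps_const ` V)"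
      then have "F $ n \<in> fps_const ` V" for n by (simp add: series_def)
      then have "F $ n $ 0 \<in> V" for n by (metis imageE fps_nth_fps_const)
      then show "\<phi> F \<in> series V" by (simp add: series_def \<phi>_def)
    qed
  next
    show "(\<lambda>x. Abs_fps (\<lambda>n. fps_const (x $ n))) \<in> series V \<rightarrow> series (fps_const ` V)"
      by (auto simp: series_def)
  next
    fix F assume "F \<in> series (fps_const ` V)"
    then show "Abs_fps (\<lambda>n. fps_const (\<phi> F $ n)) = F"
      by (intro fps_ext) (simp add: \<phi>_def flip: const)
  next
    fix x assume "x \<in> series V"
    show "\<phi> (Abs_fps (\<lambda>n. fps_const (x $ n))) = x"
      by (simp add: \<phi>_def fps_eq_iff)
  qed
  moreover have "\<phi> (F + G) = \<phi> F + \<phi> G" for F G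
    by (simp add: \<phi>_def fps_eq_iff)
  moreover have "\<phi> (series_scale t c F) = series_scale s c (\<phi> F)" for c F
  proof (rule fps_ext)
    fix n
    have "\<phi> (series_scale t c F) $ n = (\<Sum>i=0..n. t (c $ i) (F $ (n - i)) $ 0)"
      by (simp add: \<phi>_def series_scale_def fps_sum_nth)
    then show "\<phi> (series_scale t c F) $ n = series_scale s c (\<phi> F) $ n"
      by (simp add: t_def series_scale_const[OF assms(1)])
        (simp add: series_scale_def \<phi>_def)
  qed
  ultimately have "linear_iso_on (series_scale t) (series (fps_const ` V)) (series_scale s)
      (series V) \<phi>"
    by (simp add: linear_iso_on_def)
  then have "\<exists>V' \<phi>. t.subspace V' \<and>
      linear_iso_on (series_scale t) (series V') (series_scale s) (series V) \<phi>"
    using sub by (intro exI conjI)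
  then show ?thesis
    using h.module_axioms subspace_series[OF assms]
    by (simp add: topologically_free_def t_def)
qed

lemma vector_space_double_scale:
  assumes "vector_space s"
  shows "vector_space (double_scale s)"
proof -
  interpret vector_space s by fact
  show ?thesis
    by unfold_locales (auto simp: double_scale_def scale_right_distrib scale_left_distrib
        algebra_simps plus_fun_def prod_eq_iff)
qed

lemma subspace_double:
  fixes s :: "'k::field_char_0 \<Rightarrow> 'v::ab_group_add \<Rightarrow> 'v"
  assumes "vector_space s"
  shows "module.subspace (double_scale s) (double s)"
    and "module.subspace (double_scale s) double_A"
    and "module.subspace (double_scale s) (double_A_dual s)"
proof -
  interpret vector_space s by fact
  interpret d: vector_space "double_scale s" by (rule vector_space_double_scale) fact
  have lin: "f \<in> dual s \<longleftrightarrow> (\<forall>x y. f (x + y) = f x + f y) \<and> (\<forall>c x. f (s c x) = c * f x)" for f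
  proof -
    have "vector_space ((*) :: 'k \<Rightarrow> 'k \<Rightarrow> 'k)"
      by unfold_locales (simp_all add: algebra_simps)
    then show ?thesis
      by (simp add: dual_def Vector_Spaces.linear_iff assms)
  qed
  show "d.subspace (double s)"
    by (auto simp: d.subspace_def double_def lin double_scale_def zero_prod_def algebra_simps)
  show "d.subspace double_A"
    by (auto simp: d.subspace_def double_A_def double_scale_def zero_prod_def zero_fun_def)
  show "d.subspace (double_A_dual s)"
    by (auto simp: d.subspace_def double_A_dual_def lin double_scale_def zero_prod_def
        algebra_simps)
qed

lemma cong_mod_h_iff:
  fixes s :: "'k::field_char_0 \<Rightarrow> 'v::ab_group_add \<Rightarrow> 'v"
  assumes "module s" "module.subspace s V" "u \<in> series V" "v \<in> series V"
  shows "cong_mod_h s V u v \<longleftrightarrow> u $ 0 = v $ 0"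
proof -
  interpret module s by fact
  have X: "series_scale s fps_X w $ n = (if n = 0 then 0 else w $ (n - 1))" for w n
  proof -
    have "series_scale s fps_X w $ n = (\<Sum>i=0..n. if i = 1 then w $ (n - 1) else 0)"
      unfolding series_scale_def fps_nth_Abs_fps by (rule sum.cong) auto
    then show ?thesis by simp
  qed
  show ?thesis
  proof
    assume "cong_mod_h s V u v"
    then obtain w where "u - v = series_scale s fps_X w" by (auto simp: cong_mod_h_def)
    from arg_cong[OF this, of "\<lambda>z. z $ 0"] show "u $ 0 = v $ 0" by (simp add: X)
  next
    assume eq: "u $ 0 = v $ 0"
    define w where "w = Abs_fps (\<lambda>n. (u - v) $ Suc n)"
    have "w \<in> series V"
      using assms subspace_diff[OF assms(2)] by (auto simp: w_def series_def)
    moreover have "u - v = series_scale s fps_X w"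
      using eq by (auto simp: fps_eq_iff X w_def)
    ultimately show "cong_mod_h s V u v" by (auto simp: cong_mod_h_def)
  qed
qed

end

theory Submission
  imports Defs
begin

text \<open>
  The commutator of two series vanishes modulo \<open>h\<close>, because \<open>\<odot>\<close> is commutative. It is therefore
  \<open>h\<close> times a unique series, the bracket \<open>bracket_h\<close> on \<open>C[[h]]\<close>. Multiplication by \<open>h\<close> is
  injective on \<open>C[[h]]\<close>, so every identity of the commutator that is homogeneous in the number of
  commutators can be divided by the corresponding power of \<open>h\<close>: \<open>bracket_h\<close> is \<open>\<K>\<close>-bilinear, it
  satisfies the Jacobi identity, and each \<open>bracket_h u\<close> is a derivation of \<open>\<odot>\<^sub>h\<close>.

  Taking the constant coefficient is a homomorphism from \<open>\<odot>\<^sub>h\<close> to \<open>\<odot>\<close> and from \<open>bracket_h\<close> to the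
  bracket of the quasiclassical limit. For the bracket the point is that \<open>bracket_h\<close> is bilinear
  over \<open>\<K>\<close>, so a multiple of \<open>h\<close> in either argument changes the value by a multiple of \<open>h\<close> only.
  The Poisson axioms on \<open>C\<close> are thus the constant coefficients of the identities on \<open>C[[h]]\<close>.

  The conditions on Manin triples pass to the limit in the same way. If \<open>U[[h]]\<close> is closed under
  \<open>\<odot>\<^sub>h\<close>, it is closed under the commutator, hence \<open>U\<close> under the bracket. Invariance together with
  symmetry of the form on \<open>(A \<oplus> A\<^sup>*)\<^sub>h\<close> yields invariance under commutators, whose coefficient at
  \<open>h\<close> is invariance of the form on \<open>A \<oplus> A\<^sup>*\<close> under the bracket.
\<close>

section \<open>Multiplication by $h$\<close>

lemma series_scale_X_nth:
  fixes s :: "'k::field_char_0 \<Rightarrow> 'v::ab_group_add \<Rightarrow> 'v"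
  assumes "module s"
  shows "series_scale s fps_X w $ n = (if n = 0 then 0 else w $ (n - 1))"
proof -
  interpret module s by fact
  have "series_scale s fps_X w $ n = (\<Sum>i=0..n. if i = 1 then w $ (n - 1) else 0)"
    unfolding series_scale_def fps_nth_Abs_fps by (rule sum.cong) auto
  then show ?thesis by simp
qed

lemma series_scale_X_cancel:
  fixes s :: "'k::field_char_0 \<Rightarrow> 'v::ab_group_add \<Rightarrow> 'v"
  assumes "module s" "series_scale s fps_X u = series_scale s fps_X v"
  shows "u = v"
proof (rule fps_ext)
  fix n
  show "u $ n = v $ n"
    using arg_cong[OF assms(2), of "\<lambda>w. w $ Suc n"] by (simp add: series_scale_X_nth[OF assms(1)])
qed

lemma series_scale_X_shift:
  fixes s :: "'k::field_char_0 \<Rightarrow> 'v::ab_group_add \<Rightarrow> 'v"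
  assumes "module s" "u $ 0 = 0"
  shows "series_scale s fps_X (fps_shift 1 u) = u"
  by (rule fps_ext) (simp add: series_scale_X_nth[OF assms(1)] assms(2))

lemma fps_shift_in_series: "u \<in> series C \<Longrightarrow> fps_shift n u \<in> series C"
  by (simp add: series_def)

section \<open>The quasiclassical limit\<close>

locale commutative_deformation =
  fixes s :: "'k::field_char_0 \<Rightarrow> 'v::ab_group_add \<Rightarrow> 'v"
    and C :: "'v set" and m :: "'v \<Rightarrow> 'v \<Rightarrow> 'v"
    and mh :: "'v fps \<Rightarrow> 'v fps \<Rightarrow> 'v fps"
  assumes deformation: "associative_deformation s C m mh"
    and commutative: "commutative_on C m"
begin

lemma module_scale: "module s"
  and subspace_carrier: "module.subspace s C"
  using deformation by (auto simp: associative_deformation_def associative_algebra_def)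

sublocale module s by (rule module_scale)
sublocale h: module "series_scale s" by (rule module_series_scale[OF module_scale])

lemma subspace_carrier_h: "h.subspace (series C)"
  by (rule subspace_series[OF module_scale subspace_carrier])

lemma const_in_series: "x \<in> C \<Longrightarrow> fps_const x \<in> series C"
  using subspace_0[OF subspace_carrier] by (simp add: series_def)

lemma coeff_in_carrier: "u \<in> series C \<Longrightarrow> u $ n \<in> C"
  by (simp add: series_def)

lemmas add_in_series = h.subspace_add[OF subspace_carrier_h]
  and diff_in_series = h.subspace_diff[OF subspace_carrier_h]
  and scale_in_series = h.subspace_scale[OF subspace_carrier_h]

lemma associative_algebra_h: "associative_algebra (series_scale s) (series C) mh"
  using deformation
  by (simp add: associative_deformation_def topologically_free_associative_algebra_def)

lemma mh_closed: "u \<in> series C \<Longrightarrow> v \<in> series C \<Longrightarrow> mh u v \<in> series C"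
  using associative_algebra_h by (simp add: associative_algebra_def bilinear_op_on_def)

lemma
  assumes "u \<in> series C" "v \<in> series C" "w \<in> series C"
  shows mh_add_left: "mh (u + v) w = mh u w + mh v w"
    and mh_add_right: "mh u (v + w) = mh u v + mh u w"
    and mh_assoc: "mh (mh u v) w = mh u (mh v w)"
  using assms associative_algebra_h by (simp_all add: associative_algebra_def bilinear_op_on_def)

lemma
  assumes "u \<in> series C" "v \<in> series C"
  shows mh_scale_left: "mh (series_scale s c u) v = series_scale s c (mh u v)"
    and mh_scale_right: "mh u (series_scale s c v) = series_scale s c (mh u v)"
  using assms associative_algebra_h by (simp_all add: associative_algebra_def bilinear_op_on_def)

lemma
  assumes "u \<in> series C" "v \<in> series C" "w \<in> series C"
  shows mh_diff_left: "mh (u - v) w = mh u w - mh v w"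
    and mh_diff_right: "mh u (v - w) = mh u v - mh u w"
proof -
  have "mh (u - v) w + mh v w = mh u w"
    using assms mh_add_left[of "u - v" v w] by (simp add: diff_in_series)
  then show "mh (u - v) w = mh u w - mh v w" by (simp add: algebra_simps)
  have "mh u (v - w) + mh u w = mh u v"
    using assms mh_add_right[of u "v - w" w] by (simp add: diff_in_series)
  then show "mh u (v - w) = mh u v - mh u w" by (simp add: algebra_simps)
qed

lemma series_split:
  "u = fps_const (u $ 0) + series_scale s fps_X (fps_shift 1 u)"
  by (rule fps_ext) (simp add: series_scale_X_nth[OF module_scale])

text \<open>
  A \<open>\<K>\<close>-bilinear operation on \<open>C[[h]]\<close> maps multiples of \<open>h\<close> to multiples of \<open>h\<close>, so it induces
  an operation on the quotient \<open>C[[h]]/hC[[h]] = C\<close>.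
\<close>

lemma bilinear_constant_coeff:
  assumes bil: "bilinear_op_on (series_scale s) (series C) b"
    and u: "u \<in> series C" and v: "v \<in> series C"
  shows "b u v $ 0 = b (fps_const (u $ 0)) (fps_const (v $ 0)) $ 0"
proof -
  define u0 v0 u1 v1 where "u0 = fps_const (u $ 0)" and "v0 = fps_const (v $ 0)"
    and "u1 = fps_shift 1 u" and "v1 = fps_shift 1 v"
  have mem: "u0 \<in> series C" "v0 \<in> series C" "u1 \<in> series C" "v1 \<in> series C"
    using u v
    by (auto simp: u0_def v0_def u1_def v1_def
        intro: const_in_series coeff_in_carrier fps_shift_in_series)
  have X: "series_scale s fps_X w \<in> series C" if "w \<in> series C" for w
    using that by (rule scale_in_series)
  have "b u v = b (u0 + series_scale s fps_X u1) v"
    unfolding u0_def u1_def using series_split[of u] by simp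
  also have "\<dots> = b u0 v + series_scale s fps_X (b u1 v)"
    using bil mem v X by (simp add: bilinear_op_on_def)
  finally have left: "b u v $ 0 = b u0 v $ 0"
    by (simp add: series_scale_X_nth[OF module_scale])
  have "b u0 v = b u0 (v0 + series_scale s fps_X v1)"
    unfolding v0_def v1_def using series_split[of v] by simp
  also have "\<dots> = b u0 v0 + series_scale s fps_X (b u0 v1)"
    using bil mem X by (simp add: bilinear_op_on_def)
  finally have "b u0 v $ 0 = b u0 v0 $ 0"
    by (simp add: series_scale_X_nth[OF module_scale])
  with left show ?thesis by (simp add: u0_def v0_def)
qed

lemma m_closed: "x \<in> C \<Longrightarrow> y \<in> C \<Longrightarrow> m x y \<in> C"
  using deformation
  by (simp add: associative_deformation_def associative_algebra_def bilinear_op_on_def)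

lemma mh_constant_coeff:
  assumes "u \<in> series C" "v \<in> series C"
  shows "mh u v $ 0 = m (u $ 0) (v $ 0)"
proof -
  have C: "u $ 0 \<in> C" "v $ 0 \<in> C" using assms by (simp_all add: coeff_in_carrier)
  then have "cong_mod_h s C (mh (fps_const (u $ 0)) (fps_const (v $ 0)))
      (fps_const (m (u $ 0) (v $ 0)))"
    using deformation by (simp add: associative_deformation_def)
  then have "mh (fps_const (u $ 0)) (fps_const (v $ 0)) $ 0 = m (u $ 0) (v $ 0)"
    using C by (simp add: cong_mod_h_iff[OF module_scale subspace_carrier]
        mh_closed const_in_series m_closed)
  moreover have "bilinear_op_on (series_scale s) (series C) mh"
    using associative_algebra_h by (simp add: associative_algebra_def)
  ultimately show ?thesis
    using bilinear_constant_coeff[of mh u v] assms by simp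
qed

definition commutator_h :: "'v fps \<Rightarrow> 'v fps \<Rightarrow> 'v fps" where
  "commutator_h u v = mh u v - mh v u"

definition bracket_h :: "'v fps \<Rightarrow> 'v fps \<Rightarrow> 'v fps" where
  "bracket_h u v = fps_shift 1 (commutator_h u v)"

lemma bracket_h_closed: "u \<in> series C \<Longrightarrow> v \<in> series C \<Longrightarrow> bracket_h u v \<in> series C"
  by (simp add: bracket_h_def commutator_h_def fps_shift_in_series diff_in_series mh_closed)

text \<open>
  The shift in the definition of \<open>bracket_h\<close> is a division by \<open>h\<close> without remainder: the
  coefficient it drops is the commutator for \<open>\<odot>\<close>, which is zero.
\<close>

lemma X_bracket_h:
  assumes "u \<in> series C" "v \<in> series C"
  shows "series_scale s fps_X (bracket_h u v) = commutator_h u v"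
proof -
  have "commutator_h u v $ 0 = 0"
    using assms commutative
    by (simp add: commutator_h_def mh_constant_coeff coeff_in_carrier commutative_on_def)
  then show ?thesis
    unfolding bracket_h_def by (rule series_scale_X_shift[OF module_scale])
qed

lemma commutator_h_scale_right:
  assumes "u \<in> series C" "v \<in> series C"
  shows "commutator_h u (series_scale s c v) = series_scale s c (commutator_h u v)"
  using assms
  by (simp add: commutator_h_def mh_scale_left mh_scale_right h.scale_right_diff_distrib)

lemma bracket_h_antisym: "bracket_h u v = - bracket_h v u"
  by (simp add: bracket_h_def commutator_h_def fps_eq_iff)

lemma bilinear_bracket_h: "bilinear_op_on (series_scale s) (series C) bracket_h"
proof -
  have add: "bracket_h u (v + w) = bracket_h u v + bracket_h u w"
    if "u \<in> series C" "v \<in> series C" "w \<in> series C" for u v w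
  proof (rule series_scale_X_cancel[OF module_scale])
    have "commutator_h u (v + w) = commutator_h u v + commutator_h u w"
      using that by (simp add: commutator_h_def mh_add_left mh_add_right)
    then show "series_scale s fps_X (bracket_h u (v + w))
        = series_scale s fps_X (bracket_h u v + bracket_h u w)"
      using that by (simp add: h.scale_right_distrib X_bracket_h add_in_series del: h.scale_scale)
  qed
  have scale: "bracket_h u (series_scale s c v) = series_scale s c (bracket_h u v)"
    if "u \<in> series C" "v \<in> series C" for c u v
  proof (rule series_scale_X_cancel[OF module_scale])
    have "series_scale s fps_X (bracket_h u (series_scale s c v))
        = series_scale s c (series_scale s fps_X (bracket_h u v))"
      using that by (simp only: X_bracket_h scale_in_series commutator_h_scale_right)
    then show "series_scale s fps_X (bracket_h u (series_scale s c v))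
        = series_scale s fps_X (series_scale s c (bracket_h u v))"
      by (simp add: mult.commute)
  qed
  have "bracket_h (u + v) w = bracket_h u w + bracket_h v w"
    if "u \<in> series C" "v \<in> series C" "w \<in> series C" for u v w
    using add[of w u v] that by (simp add: bracket_h_antisym[of _ w])
  moreover have "bracket_h (series_scale s c u) v = series_scale s c (bracket_h u v)"
    if "u \<in> series C" "v \<in> series C" for c u v
    using scale[of v u c] that by (simp add: bracket_h_antisym[of _ v])
  ultimately show ?thesis
    using bracket_h_closed add scale by (simp add: bilinear_op_on_def)
qed

text \<open>
  The inner factor \<open>h\<close> moves through the outer commutator, so nested brackets are nested
  commutators divided by \<open>h\<^sup>2\<close>; this reduces the Jacobi identity to that of the commutator.
\<close>

lemma X_X_bracket_h:
  assumes "u \<in> series C" "v \<in> series C" "w \<in> series C"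
  shows "series_scale s fps_X (series_scale s fps_X (bracket_h u (bracket_h v w)))
    = commutator_h u (commutator_h v w)"
  using assms commutator_h_scale_right[of u "bracket_h v w" fps_X]
  by (simp only: X_bracket_h bracket_h_closed)

lemma bracket_h_jacobi:
  assumes "u \<in> series C" "v \<in> series C" "w \<in> series C"
  shows "bracket_h u (bracket_h v w) + bracket_h v (bracket_h w u)
    + bracket_h w (bracket_h u v) = 0" (is "?J = 0")
proof -
  have "commutator_h u (commutator_h v w) + commutator_h v (commutator_h w u)
    + commutator_h w (commutator_h u v) = 0"
    using assms
    by (simp add: commutator_h_def mh_diff_left mh_diff_right mh_closed diff_in_series mh_assoc)
  then have "series_scale s fps_X (series_scale s fps_X ?J)
      = series_scale s fps_X (series_scale s fps_X 0)"
    using assms by (simp only: h.scale_right_distrib X_X_bracket_h) simp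
  then show ?thesis by (blast dest: series_scale_X_cancel[OF module_scale])
qed

lemma bracket_h_leibniz:
  assumes "u \<in> series C" "v \<in> series C" "w \<in> series C"
  shows "bracket_h u (mh v w) = mh (bracket_h u v) w + mh v (bracket_h u w)"
proof (rule series_scale_X_cancel[OF module_scale])
  have "commutator_h u (mh v w) = mh (commutator_h u v) w + mh v (commutator_h u w)"
    using assms by (simp add: commutator_h_def mh_diff_left mh_diff_right mh_closed mh_assoc)
  also have "\<dots> = mh (series_scale s fps_X (bracket_h u v)) w
      + mh v (series_scale s fps_X (bracket_h u w))"
    using assms by (simp only: X_bracket_h)
  also have "\<dots> = series_scale s fps_X (mh (bracket_h u v) w + mh v (bracket_h u w))"
    using assms by (simp only: mh_scale_left mh_scale_right bracket_h_closed h.scale_right_distrib)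
  finally show "series_scale s fps_X (bracket_h u (mh v w))
      = series_scale s fps_X (mh (bracket_h u v) w + mh v (bracket_h u w))"
    using assms by (simp only: X_bracket_h mh_closed)
qed

abbreviation bracket :: "'v \<Rightarrow> 'v \<Rightarrow> 'v" where
  "bracket \<equiv> qcl_bracket s C mh"

text \<open>
  The quotient of the commutator by \<open>h\<close> is unique because \<open>h\<close> can be cancelled, so the definite
  description in \<open>qcl_bracket\<close> has a unique solution.
\<close>

lemma bracket_eq:
  assumes x: "x \<in> C" and y: "y \<in> C"
  shows "bracket x y = bracket_h (fps_const x) (fps_const y) $ 0"
  unfolding qcl_bracket_def
proof (rule the_equality)
  have b: "bracket_h (fps_const x) (fps_const y) \<in> series C"
    using x y by (simp add: bracket_h_closed const_in_series)
  have X: "series_scale s fps_X (bracket_h (fps_const x) (fps_const y))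
      = mh (fps_const x) (fps_const y) - mh (fps_const y) (fps_const x)"
    using X_bracket_h x y by (simp add: commutator_h_def const_in_series)
  let ?c = "bracket_h (fps_const x) (fps_const y) $ 0"
  show "?c \<in> C \<and> (\<exists>z\<in>series C. series_scale s fps_X z
      = mh (fps_const x) (fps_const y) - mh (fps_const y) (fps_const x) \<and>
      cong_mod_h s C (fps_const ?c) z)"
    using b X coeff_in_carrier[OF b, of 0]
    by (auto simp: cong_mod_h_iff[OF module_scale subspace_carrier] const_in_series)
  fix c
  assume "c \<in> C \<and> (\<exists>z\<in>series C. series_scale s fps_X z
      = mh (fps_const x) (fps_const y) - mh (fps_const y) (fps_const x) \<and>
      cong_mod_h s C (fps_const c) z)"
  then obtain z where z: "c \<in> C" "z \<in> series C"
      "series_scale s fps_X z = mh (fps_const x) (fps_const y) - mh (fps_const y) (fps_const x)"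
      "cong_mod_h s C (fps_const c) z"
    by blast
  have "z = bracket_h (fps_const x) (fps_const y)"
    by (rule series_scale_X_cancel[OF module_scale]) (simp add: z X)
  then show "c = ?c"
    using z by (simp add: cong_mod_h_iff[OF module_scale subspace_carrier] const_in_series)
qed

lemma bracket_h_constant_coeff:
  assumes "u \<in> series C" "v \<in> series C"
  shows "bracket_h u v $ 0 = bracket (u $ 0) (v $ 0)"
  using assms bilinear_constant_coeff[OF bilinear_bracket_h]
  by (simp add: bracket_eq coeff_in_carrier)

lemma bilinear_bracket: "bilinear_op_on s C bracket"
proof -
  have scale: "fps_const (s c x) = series_scale s (fps_const c) (fps_const x)" for c x
    by (rule fps_ext) (simp add: series_scale_const[OF module_scale])
  show ?thesis
    using bilinear_bracket_h subspace_carrier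
    by (auto simp: bilinear_op_on_def bracket_eq const_in_series coeff_in_carrier subspace_add
        subspace_scale scale series_scale_const[OF module_scale] simp flip: fps_const_add)
qed

theorem poisson_algebra_qcl: "poisson_algebra s C bracket m"
proof -
  note const = const_in_series mh_closed bracket_h_closed
  have "bracket x x = 0" if "x \<in> C" for x
    using that by (simp add: bracket_eq bracket_h_def commutator_h_def)
  moreover have "bracket x (bracket y z) + bracket y (bracket z x) + bracket z (bracket x y) = 0"
    if "x \<in> C" "y \<in> C" "z \<in> C" for x y z
    using arg_cong[OF bracket_h_jacobi[of "fps_const x" "fps_const y" "fps_const z"],
        of "\<lambda>w. w $ 0"] that
    by (simp add: bracket_h_constant_coeff const)
  moreover have "bracket x (m y z) = m (bracket x y) z + m y (bracket x z)"
    if "x \<in> C" "y \<in> C" "z \<in> C" for x y z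
    using arg_cong[OF bracket_h_leibniz[of "fps_const x" "fps_const y" "fps_const z"],
        of "\<lambda>w. w $ 0"] that
    by (simp add: bracket_h_constant_coeff mh_constant_coeff const)
  moreover have "associative_algebra s C m"
    using deformation by (simp add: associative_deformation_def)
  ultimately show ?thesis
    unfolding poisson_algebra_def lie_algebra_def
    using commutative bilinear_bracket module_scale subspace_carrier by blast
qed

lemma subalgebra_qcl:
  assumes U: "subalgebra s C m U"
    and sub: "subalgebra (series_scale s) (series C) mh (series U)"
  shows "subalgebra s C bracket U"
proof -
  have subU: "U \<subseteq> C" "subspace U"
    using U by (simp_all add: subalgebra_def)
  have "fps_const x \<in> series U" if "x \<in> U" for x
    using that subspace_0[OF subU(2)] by (simp add: series_def)
  then have "mh (fps_const x) (fps_const y) $ n \<in> U" if "x \<in> U" "y \<in> U" for x y n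
    using that sub by (simp add: subalgebra_def series_def)
  then have "bracket x y \<in> U" if "x \<in> U" "y \<in> U" for x y
    using that subU subU(1)[THEN subsetD]
    by (simp add: bracket_eq bracket_h_def commutator_h_def subspace_diff)
  then show ?thesis using subU by (simp add: subalgebra_def)
qed

end

section \<open>The form on the double\<close>

lemma form_commute: "form u v = form v u"
  by (simp add: form_def add.commute)

lemma dual_additive:
  assumes "f \<in> dual s"
  shows "f (x + y) = f x + f y"
  using assms by (simp add: dual_def Vector_Spaces.linear_iff)

lemma form_add_left:
  assumes "w \<in> double s"
  shows "form (u + v) w = form u w + form v w"
  using assms by (cases w) (simp add: form_def double_def dual_additive algebra_simps)

lemma form_zero_left: "w \<in> double s \<Longrightarrow> form 0 w = 0"
  using form_add_left[of w s 0 0] by simp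

lemma form_h_nth: "form_h u v $ n = (\<Sum>i=0..n. form (u $ i) (v $ (n - i)))"
proof -
  have "(\<Sum>i=0..n. snd (v $ i) (fst (u $ (n - i)))) = (\<Sum>i=0..n. snd (v $ (n - i)) (fst (u $ i)))"
    by (subst sum.atLeastAtMost_rev) simp
  then show ?thesis
    by (simp add: form_h_def pairing_h_def form_def sum.distrib)
qed

lemma form_h_commute: "form_h u v = form_h v u"
proof (rule fps_ext)
  fix n
  have "form_h u v $ n = (\<Sum>i=0..n. form (u $ (n - i)) (v $ i))"
    unfolding form_h_nth by (subst sum.atLeastAtMost_rev) simp
  then show "form_h u v $ n = form_h v u $ n"
    by (simp add: form_h_nth form_commute)
qed

lemma form_h_add_left:
  assumes "w \<in> series (double s)"
  shows "form_h (u + v) w = form_h u w + form_h v w"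
  using assms
  by (intro fps_ext) (simp add: form_h_nth series_def form_add_left[of _ s] sum.distrib)

lemma form_h_diff_left:
  assumes "w \<in> series (double s)"
  shows "form_h (u - v) w = form_h u w - form_h v w"
  using form_h_add_left[OF assms, of "u - v" v] by (simp add: algebra_simps)

text \<open>
  Applied to a commutator \<open>h \<cdot> bracket_h u v\<close>, this recovers the form evaluated at the bracket of the
  quasiclassical limit.
\<close>

lemma form_h_X_left_nth_1:
  fixes t :: "'k::field_char_0 \<Rightarrow> 'a \<times> ('a \<Rightarrow> 'k) \<Rightarrow> 'a::ab_group_add \<times> ('a \<Rightarrow> 'k)"
  assumes "module t" "w \<in> series (double s)"
  shows "form_h (series_scale t fps_X u) w $ 1 = form (u $ 0) (w $ 0)"
  using assms(2)
  by (simp add: form_h_nth series_scale_X_nth[OF assms(1)] form_zero_left[of _ s] series_def)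

text \<open>
  Invariance moves \<open>v\<close> from the product \<open>u \<odot>\<^sub>h v\<close> in the first argument of the form to the product
  \<open>v \<odot>\<^sub>h w\<close> in the second. The symmetry of the form gives the mirror image of this rule, which
  turns \<open>v \<odot>\<^sub>h u\<close> paired with \<open>w\<close> into \<open>w \<odot>\<^sub>h v\<close> paired with \<open>u\<close>. The arguments on the right
  are swapped so that both commutators stand first, where linearity and division by \<open>h\<close> apply.
\<close>

lemma invariant_form_h_commutator:
  assumes inv: "invariant_form (series (double s)) mh form_h"
    and mem: "u \<in> series (double s)" "v \<in> series (double s)" "w \<in> series (double s)"
  shows "form_h (mh u v - mh v u) w = form_h (mh v w - mh w v) u"
proof -
  have "form_h (mh u v) w = form_h (mh v w) u"
    using inv mem form_h_commute by (metis invariant_form_def)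
  moreover have "form_h (mh v u) w = form_h (mh w v) u"
    using inv mem form_h_commute by (metis invariant_form_def)
  ultimately show ?thesis
    using mem by (simp add: form_h_diff_left[of _ s])
qed

theorem theorem4p6:
  fixes s :: "'k::field_char_0 \<Rightarrow> 'a::ab_group_add \<Rightarrow> 'a"
    and m :: "'a \<times> ('a \<Rightarrow> 'k) \<Rightarrow> 'a \<times> ('a \<Rightarrow> 'k) \<Rightarrow> 'a \<times> ('a \<Rightarrow> 'k)"
    and mh :: "('a \<times> ('a \<Rightarrow> 'k)) fps \<Rightarrow> ('a \<times> ('a \<Rightarrow> 'k)) fps \<Rightarrow> ('a \<times> ('a \<Rightarrow> 'k)) fps"
  assumes "vector_space s"
    and "manin_triple_comm_assoc s m"
    and "manin_triple_deformation s m mh"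
  shows "manin_triple_poisson s (qcl_bracket (double_scale s) (double s) mh) m"
proof -
  interpret commutative_deformation "double_scale s" "double s" m mh
    using assms(2,3)
    by unfold_locales (simp_all add: manin_triple_comm_assoc_def manin_triple_deformation_def)
  have h: "subalgebra (series_scale (double_scale s)) (series (double s)) mh (series double_A)"
    "subalgebra (series_scale (double_scale s)) (series (double s)) mh (series (double_A_dual s))"
    "invariant_form (series (double s)) mh form_h"
    using assms(3) by (simp_all add: manin_triple_deformation_def manin_triple_assoc_h_def Let_def)
  have "manin_triple_assoc s m"
    using assms(2) by (simp add: manin_triple_comm_assoc_def)
  then have m: "subalgebra (double_scale s) (double s) m double_A"
    "subalgebra (double_scale s) (double s) m (double_A_dual s)"
    "invariant_form (double s) m form"
    by (simp_all add: manin_triple_assoc_def)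
  have "form (bracket x y) z = form x (bracket y z)"
    if "x \<in> double s" "y \<in> double s" "z \<in> double s" for x y z
  proof -
    let ?u = "fps_const x" and ?v = "fps_const y" and ?w = "fps_const z"
    have mem: "?u \<in> series (double s)" "?v \<in> series (double s)" "?w \<in> series (double s)"
      using that by (simp_all add: const_in_series)
    have "form_h (commutator_h ?u ?v) ?w = form_h (commutator_h ?v ?w) ?u"
      unfolding commutator_h_def
      by (rule invariant_form_h_commutator[OF h(3) mem])
    then have "form (bracket_h ?u ?v $ 0) z = form (bracket_h ?v ?w $ 0) x"
      using mem form_h_X_left_nth_1[OF module_scale, of _ s] by (metis X_bracket_h fps_nth_fps_const)
    then show ?thesis
      using that by (simp add: bracket_eq form_commute)
  qed
  then show ?thesis
    using poisson_algebra_qcl m subalgebra_qcl[OF m(1) h(1)] subalgebra_qcl[OF m(2) h(2)]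
    by (simp add: manin_triple_poisson_def invariant_form_def)
qed

end
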